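(* Let $K$ be a field. There exists an additive function $f:K\to K$ which is not identically zero and which satisfies $f(x)f\left(\frac{1}{x}\right)=0$ for every $x\in K$ with $x\neq 0$ if and only if $K$ is transcendental over $\mathbb{Q}$ (when $K$ has characteristic zero) or over $\mathbb{F}_p$ (when $K$ has characteristic $p>0$).
   Context: A function $f:K\to K$ on a field $K$ is additive if $f(x+y)=f(x)+f(y)$ for all $x,y\in K$. The field with $p$ elements is denoted $\mathbb{F}_p$. A field $K$ is transcendental over its prime field ($\mathbb{Q}$ or $\mathbb{F}_p$) if it is not algebraic over it, i.e. if $K$ contains an element that is transcendental over the prime field. *)

theory Defs
  imports "HOL-Computational_Algebra.Polynomial"
begin

definition subfield_set :: "'a::field set \<Rightarrow> bool" where
  "subfield_set F \<longleftrightarrow> 0 \<in> F \<and> 1 \<in> F \<and>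
     (\<forall>x\<in>F. \<forall>y\<in>F. x + y \<in> F \<and> x * y \<in> F) \<and>
     (\<forall>x\<in>F. - x \<in> F \<and> inverse x \<in> F)"

definition prime_subfield :: "'a::field set" where
  "prime_subfield = \<Inter> {F. subfield_set F}"

definition transcendental_over :: "'a::field set \<Rightarrow> 'a \<Rightarrow> bool" where
  "transcendental_over F x \<longleftrightarrow>
     \<not> (\<exists>p. (\<forall>i. coeff p i \<in> F) \<and> p \<noteq> 0 \<and> poly p x = 0)"

lemma subfield_set_prime_subfield: "subfield_set prime_subfield"
  unfolding prime_subfield_def subfield_set_def by auto

lemma of_nat_in_subfield_set: "subfield_set F \<Longrightarrow> of_nat n \<in> F"
  by (induction n) (auto simp: subfield_set_def)

lemma of_int_in_subfield_set: "subfield_set F \<Longrightarrow> of_int n \<in> F"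
  using of_nat_in_subfield_set[of F]
  by (cases n rule: int_cases2) (auto simp: subfield_set_def)

text \<open>In characteristic zero the prime field is the library's \<^term>\<open>\<rat>\<close>; in characteristic
  \<open>p > 0\<close> it consists of the \<open>p\<close> elements \<open>0, 1, \<dots>, p - 1\<close>.\<close>

lemma prime_subfield_char_0: "(prime_subfield :: 'a::field_char_0 set) = \<rat>"
proof
  have "subfield_set (\<rat> :: 'a set)"
    by (auto simp: subfield_set_def)
  thus "(prime_subfield :: 'a set) \<subseteq> \<rat>"
    unfolding prime_subfield_def by blast
next
  show "\<rat> \<subseteq> (prime_subfield :: 'a set)"
  proof
    fix x :: 'a assume "x \<in> \<rat>"
    then obtain a b where x: "x = of_int a / of_int b"
      by (auto elim: Rats_cases')
    show "x \<in> prime_subfield"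
      unfolding x divide_inverse
      using subfield_set_prime_subfield[where 'a = 'a]
        of_int_in_subfield_set[OF subfield_set_prime_subfield[where 'a = 'a]]
      by (auto simp: subfield_set_def)
  qed
qed

lemma prime_subfield_char_p:
  assumes "CHAR('a::field) > 0"
  shows "(prime_subfield :: 'a set) = of_nat ` {..<CHAR('a)}"
    and "card (prime_subfield :: 'a set) = CHAR('a)"
proof -
  let ?p = "CHAR('a)"
  let ?P = "of_nat ` {..<?p} :: 'a set"
  have p: "prime ?p"
    using assms by (rule prime_CHAR_semidom)
  have red: "(of_nat (n mod ?p) :: 'a) = of_nat n" for n
    by (metis (no_types, lifting) add.right_neutral mod_mult_div_eq mult_zero_left
        of_nat_CHAR of_nat_add of_nat_mult)
  have inP: "of_nat n \<in> ?P" for n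
    using red[of n] assms by (metis image_eqI lessThan_iff mod_less_divisor)
  have "subfield_set ?P"
    unfolding subfield_set_def
  proof (intro conjI ballI)
    show "0 \<in> ?P" "1 \<in> ?P" using inP[of 0] inP[of 1] by auto
  next
    fix x y assume "x \<in> ?P" "y \<in> ?P"
    then obtain m n where xy: "x = of_nat m" "y = of_nat n" by auto
    show "x + y \<in> ?P" "x * y \<in> ?P"
      unfolding xy using inP[of "m + n"] inP[of "m * n"] by auto
  next
    fix x assume "x \<in> ?P"
    then obtain n where n: "x = of_nat n" "n < ?p" by auto
    have "x + of_nat (?p - n) = 0"
      using n by (metis le_add_diff_inverse less_imp_le of_nat_CHAR of_nat_add)
    hence "- x = of_nat (?p - n)" by (simp add: minus_unique)
    thus "- x \<in> ?P" using inP by metis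
    show "inverse x \<in> ?P"
    proof (cases "n = 0")
      case True
      thus ?thesis using n inP[of 0] by auto
    next
      case False
      hence "coprime n ?p"
        using p n by (metis coprime_commute nat_dvd_not_less not_gr_zero prime_imp_coprime)
      then obtain a b where ab: "n * a = ?p * b + 1"
        using bezout_nat[of n ?p] False by (auto simp: coprime_iff_gcd_eq_1)
      have "x * of_nat a = 1"
        using arg_cong[OF ab, of "of_nat :: nat \<Rightarrow> 'a"] n by simp
      hence "inverse x = of_nat a" by (simp add: inverse_unique)
      thus ?thesis using inP by metis
    qed
  qed
  thus eq: "(prime_subfield :: 'a set) = ?P"
    using of_nat_in_subfield_set[OF subfield_set_prime_subfield[where 'a = 'a]]
    unfolding prime_subfield_def by blast
  have "inj_on (of_nat :: nat \<Rightarrow> 'a) {..<?p}"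
  proof (rule linorder_inj_onI)
    fix m n :: nat assume mn: "m < n" "m \<in> {..<?p}" "n \<in> {..<?p}"
    have "\<not> ?p dvd n - m"
      using mn by (auto dest: dvd_imp_le)
    hence "(of_nat (n - m) :: 'a) \<noteq> 0"
      by (simp add: of_nat_eq_0_iff_char_dvd)
    thus "(of_nat m :: 'a) \<noteq> of_nat n"
      using mn by (auto simp: of_nat_diff)
  qed auto
  thus "card (prime_subfield :: 'a set) = ?p"
    unfolding eq by (simp add: card_image)
qed

lemma transcendental_over_Rats: "transcendental_over \<rat> x \<longleftrightarrow> \<not> algebraic x"
  by (simp add: transcendental_over_def algebraic_altdef)

end

theory Submission
  imports Defs
begin

text \<open>
  Let \<open>F\<close> be the prime field of \<open>K\<close>. Only the kernel \<open>N\<close> of \<open>f\<close> matters: it is a proper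
  \<open>F\<close>-subspace of \<open>K\<close>, and the functional equation says that each \<open>x \<noteq> 0\<close> satisfies \<open>x \<in> N\<close>
  or \<open>1/x \<in> N\<close>.

  Suppose that \<open>y \<notin> N\<close>. Then \<open>y + n \<notin> N\<close> for every \<open>n \<in> N\<close>, so all the inverses \<open>1/(y + n)\<close>
  lie in \<open>N\<close>. Playing such inverses against each other by partial fractions shows that \<open>N\<close>
  contains every power \<open>y\<^sup>-\<^sup>k\<close> with \<open>k \<ge> 0\<close> (\<open>inverse_power_in_kernel\<close>). If \<open>y\<close> were algebraic of
  degree \<open>d\<close>, then dividing its equation by \<open>y\<^sup>d\<^sup>-\<^sup>1\<close> would express \<open>y\<close> as an \<open>F\<close>-linear
  combination of \<open>1, y\<^sup>-\<^sup>1, \<dots>\<close>, all of them in \<open>N\<close>. So every element outside the kernel is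
  transcendental.

  Conversely, a proper valuation ring \<open>V\<close> of \<open>K\<close> that contains \<open>F\<close> is an \<open>F\<close>-subspace containing \<open>x\<close>
  or \<open>1/x\<close> for each \<open>x \<noteq> 0\<close>, and any nonzero \<open>F\<close>-linear functional vanishing on \<open>V\<close> solves the
  functional equation. If \<open>t\<close> is transcendental, then \<open>1/t\<close> is not in \<open>F[t]\<close>, and Chevalley's
  argument (\<open>valuation_ring\<close>) shows that a subring \<open>V \<supseteq> F[t]\<close> maximal among those that omit
  \<open>1/t\<close> is a valuation ring. The functional comes from a subspace \<open>N \<supseteq> V\<close> maximal among those
  that omit \<open>1/t\<close>: then \<open>K = N \<oplus> F \<cdot> (1/t)\<close>, and the coordinate of \<open>1/t\<close> is the required
  function (\<open>additive_separating_subspace\<close>).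
\<close>

section \<open>Algebraic fields\<close>

text \<open>The scalars with which an additive function commutes form a subfield, and the prime
  field is the smallest one.\<close>

lemma additive_prime_subfield_linear:
  fixes f :: "'a::field \<Rightarrow> 'a"
  assumes "additive f" "c \<in> prime_subfield"
  shows "f (c * x) = c * f x"
proof -
  interpret additive f by fact
  let ?C = "{c. \<forall>x. f (c * x) = c * f x}"
  have "f (inverse c * x) = inverse c * f x" if "c \<in> ?C" for c x
  proof (cases "c = 0")
    case False
    have "f (c * (inverse c * x)) = c * f (inverse c * x)"
      using that by blast
    with False show ?thesis
      by (simp add: field_simps)
  qed (simp add: zero)
  then have "subfield_set ?C"
    by (auto simp: subfield_set_def zero add minus distrib_right mult.assoc)
  then show ?thesis
    using assms(2) unfolding prime_subfield_def by blast
qed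

text \<open>
  Write \<open>N\<close> for the kernel, \<open>u = 1/y\<close> and \<open>v = 1 + u\<close>, and let \<open>k\<close> be the least exponent with
  \<open>u\<^sup>k \<notin> N\<close>. The functional equation turns elements outside \<open>N\<close> into inverses inside \<open>N\<close>, and
  lower powers of \<open>u\<close> may be added freely to \<open>u\<^sup>k\<close> and to \<open>y\<close> without entering \<open>N\<close>. Three kinds
  of such elements suffice: \<open>v\<^sup>k\<close>, \<open>u v\<^sup>k\<^sup>-\<^sup>1\<close> and \<open>y v\<^sup>i\<close> for \<open>i \<le> k\<close>. Since \<open>u = v - 1\<close>, the
  inverses of the first and third kind give \<open>v\<^sup>-\<^sup>i \<in> N\<close> for \<open>i \<le> k\<close> by descent from \<open>i = k\<close>. The
  partial fraction expansion
    \<open>1 / (u v\<^sup>k\<^sup>-\<^sup>1) = y - (v\<^sup>-\<^sup>1 + \<dots> + v\<^sup>-\<^sup>(\<^sup>k\<^sup>-\<^sup>1\<^sup>))\<close>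
  then forces \<open>y \<in> N\<close>.
\<close>

lemma inverse_power_in_kernel:
  fixes f :: "'a::field \<Rightarrow> 'a"
  assumes "additive f" and inv: "\<And>x. x \<noteq> 0 \<Longrightarrow> f x * f (1 / x) = 0"
    and y: "f y \<noteq> 0"
  shows "f (inverse y ^ k) = 0"
proof (induction k rule: less_induct)
  case (less k)
  interpret additive f by fact
  define u where "u = inverse y"
  define v where "v = 1 + u"
  have kernel: "f (inverse x) = 0" if "f x \<noteq> 0" for x
    using inv[of x] that zero by (auto simp: inverse_eq_divide)
  have f1: "f 1 = 0"
    using inv[of 1] by simp
  have y0: "y \<noteq> 0" "y \<noteq> - 1"
    using y f1 zero minus[of 1] by auto
  then have v0: "v \<noteq> 0" and yu: "y * u = 1"
    unfolding v_def u_def by (auto simp: field_simps add_eq_0_iff)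
  have "f (u ^ k) = 0"
  proof (rule ccontr)
    assume uk: "f (u ^ k) \<noteq> 0"
    then have k: "k > 0"
      using f1 by (cases k) auto
    have low: "f (u ^ i) = 0" if "i < k" for i
      using less that by (simp add: u_def)
    \<comment> \<open>The monomial expands into \<open>u\<close>-powers from \<open>j\<close> to \<open>j + i\<close>, the last with coefficient 1.\<close>
    have mono: "f (u ^ j * v ^ i) = (if j + i = k then f (u ^ k) else 0)" if "j + i \<le> k" for i j
      using that
    proof (induction i arbitrary: j)
      case (Suc i)
      have "u ^ j * v ^ Suc i = u ^ j * v ^ i + u ^ Suc j * v ^ i"
        by (simp add: v_def algebra_simps)
      then show ?case
        using Suc.IH[of j] Suc.IH[of "Suc j"] Suc.prems by (simp add: add del: power_Suc)
    qed (use low in auto)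
    \<comment> \<open>\<open>y v\<^sup>i - y\<close> is a polynomial in \<open>u\<close> of degree \<open>i - 1 < k\<close> because \<open>y u = 1\<close>.\<close>
    have yv: "f (y * v ^ i) = f y" if "i \<le> k" for i
      using that
    proof (induction i)
      case (Suc i)
      have "y * v ^ Suc i = y * v ^ i + (y * u) * v ^ i"
        by (simp add: v_def algebra_simps)
      then show ?case
        using Suc mono[of 0 i] by (simp add: add yu del: power_Suc)
    qed simp
    have uv: "f (u * inverse v ^ i) = 0" if "i \<le> k" for i
      using kernel[of "y * v ^ i"] yv[OF that] y by (simp add: u_def power_inverse)
    \<comment> \<open>The descent runs as induction on \<open>i\<close>; the truncated difference is harmless past \<open>k\<close>.\<close>
    have iv: "f (inverse v ^ (k - i)) = 0" for i
    proof (induction i)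
      case 0
      show ?case
        using kernel[of "v ^ k"] mono[of 0 k] uk by (simp add: power_inverse)
    next
      case (Suc i)
      show ?case
      proof (cases "k - i")
        case (Suc l)
        have "inverse v ^ l = u * inverse v ^ Suc l + inverse v ^ Suc l"
        proof -
          have "u * inverse v ^ Suc l + inverse v ^ Suc l = (v * inverse v) * inverse v ^ l"
            by (simp add: v_def algebra_simps)
          then show ?thesis using v0 by simp
        qed
        then have "f (inverse v ^ l) = 0"
          using Suc.IH uv[of "Suc l"] Suc by (simp add: add del: power_Suc)
        moreover have "k - Suc i = l" using Suc by simp
        ultimately show ?thesis by simp
      qed (use Suc in simp)
    qed
    have "f (y * inverse v ^ i) = f y" if "i < k" for i
      using that
    proof (induction i)
      case (Suc i)
      have "y * inverse v ^ Suc i + inverse v ^ Suc i = y * inverse v ^ i"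
      proof -
        have "y * inverse v ^ Suc i + (y * u) * inverse v ^ Suc i
            = y * (v * inverse v) * inverse v ^ i"
          by (simp add: v_def algebra_simps)
        then show ?thesis using v0 yu by simp
      qed
      from arg_cong[OF this, of f] show ?case
        using Suc iv[of "k - Suc i"] by (simp add: add del: power_Suc)
    qed simp
    from this[of "k - 1"] have "f (y * inverse v ^ (k - 1)) \<noteq> 0"
      using k y by simp
    moreover have "f (u * v ^ (k - 1)) \<noteq> 0"
      using mono[of 1 "k - 1"] k uk by simp
    then have "f (y * inverse v ^ (k - 1)) = 0"
      using kernel[of "u * v ^ (k - 1)"] by (simp add: u_def power_inverse)
    ultimately show False by simp
  qed
  then show ?case by (simp add: u_def)
qed

text \<open>Multiplying an equation \<open>p(y) = 0\<close> of degree \<open>d + 1\<close> by \<open>y\<^sup>-\<^sup>d\<close> leaves \<open>y\<close> as the only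
  term outside the kernel.\<close>

lemma additive_inversion_transcendental:
  fixes f :: "'a::field \<Rightarrow> 'a"
  assumes f: "additive f" and inv: "\<And>x. x \<noteq> 0 \<Longrightarrow> f x * f (1 / x) = 0"
    and y: "f y \<noteq> 0"
  shows "transcendental_over prime_subfield y"
  unfolding transcendental_over_def
proof safe
  fix p :: "'a poly"
  assume p: "\<forall>i. coeff p i \<in> prime_subfield" "p \<noteq> 0" "poly p y = 0"
  interpret additive f by fact
  have y0: "y \<noteq> 0" using y zero by auto
  obtain d where d: "degree p = Suc d"
    using p(2,3) by (cases "degree p") (auto elim: degree_eq_zeroE)
  have shift: "inverse y ^ d * y ^ i = inverse y ^ (d - i)" if "i \<le> d" for i
    using that y0 by (simp add: power_inverse power_diff divide_inverse)
  have "0 = inverse y ^ d * poly p y"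
    using p by simp
  also have "\<dots> = (\<Sum>i\<le>Suc d. coeff p i * (inverse y ^ d * y ^ i))"
    by (simp add: poly_altdef d sum_distrib_left mult_ac distrib_left del: power_Suc)
  also have "\<dots> = (\<Sum>i\<le>d. coeff p i * inverse y ^ (d - i)) + lead_coeff p * y"
    using y0 shift by (simp add: d power_inverse)
  finally have "f 0 = f ((\<Sum>i\<le>d. coeff p i * inverse y ^ (d - i)) + lead_coeff p * y)"
    by (rule arg_cong)
  also have "\<dots> = (\<Sum>i\<le>d. coeff p i * f (inverse y ^ (d - i))) + lead_coeff p * f y"
    using p(1) by (simp add: add sum additive_prime_subfield_linear[OF f])
  finally have "f 0 = (\<Sum>i\<le>d. coeff p i * f (inverse y ^ (d - i))) + lead_coeff p * f y" .
  then show False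
    using p y by (simp add: inverse_power_in_kernel[OF f inv y] zero)
qed

section \<open>Maximal closed sets\<close>

text \<open>Both subrings and subspaces are sets closed under a family of binary operations, so one
  application of Zorn's lemma serves for the valuation ring and for the hyperplane. A unary
  operation is encoded by ignoring one argument.\<close>

definition closed_under :: "('a \<Rightarrow> 'a \<Rightarrow> 'a) set \<Rightarrow> 'a set \<Rightarrow> bool" where
  "closed_under B S \<longleftrightarrow> (\<forall>g\<in>B. \<forall>x\<in>S. \<forall>y\<in>S. g x y \<in> S)"

lemma maximal_closed_avoiding:
  assumes "closed_under B A" "z \<notin> A"
  shows "\<exists>S. closed_under B S \<and> A \<subseteq> S \<and> z \<notin> S \<and>
    (\<forall>T. closed_under B T \<longrightarrow> S \<subseteq> T \<longrightarrow> z \<notin> T \<longrightarrow> T = S)"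
proof -
  define \<A> where "\<A> = {S. closed_under B S \<and> A \<subseteq> S \<and> z \<notin> S}"
  have "\<exists>S\<in>\<A>. \<forall>T\<in>\<A>. S \<subseteq> T \<longrightarrow> T = S"
  proof (rule subset_Zorn_nonempty)
    show "\<A> \<noteq> {}"
      using assms by (auto simp: \<A>_def)
  next
    fix \<C> assume \<C>: "\<C> \<noteq> {}" "subset.chain \<A> \<C>"
    then have mem: "closed_under B X" "A \<subseteq> X" "z \<notin> X" if "X \<in> \<C>" for X
      using that by (auto simp: \<A>_def subset_chain_def)
    have "g x y \<in> \<Union>\<C>" if xy: "g \<in> B" "x \<in> X" "X \<in> \<C>" "y \<in> Y" "Y \<in> \<C>" for g x y X Y
    proof -
      have "X \<subseteq> Y \<or> Y \<subseteq> X"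
        using \<C>(2) xy(3,5) by (simp add: subset_chain_def)
      then have "x \<in> Y \<or> y \<in> X" using xy by blast
      then have "g x y \<in> X \<or> g x y \<in> Y"
        using mem(1)[OF xy(3)] mem(1)[OF xy(5)] xy unfolding closed_under_def by metis
      then show ?thesis using xy by blast
    qed
    then have "closed_under B (\<Union>\<C>)"
      unfolding closed_under_def by simp
    moreover have "A \<subseteq> \<Union>\<C>" "z \<notin> \<Union>\<C>"
      using \<C>(1) mem(2,3) by blast+
    ultimately show "\<Union>\<C> \<in> \<A>" by (simp add: \<A>_def)
  qed
  then obtain S where S: "S \<in> \<A>" "\<forall>T\<in>\<A>. S \<subseteq> T \<longrightarrow> T = S" ..
  then show ?thesis
    unfolding \<A>_def by blast
qed

text \<open>A subspace \<open>N \<supseteq> V\<close> maximal among those omitting \<open>z\<close> is a complement of the line \<open>F z\<close>: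
  enlarging \<open>N\<close> by any \<open>x \<notin> N\<close> produces \<open>z = n + c x\<close> with \<open>c \<noteq> 0\<close>, which can be solved for
  \<open>x\<close>. The function sought is the projection onto that line.\<close>

lemma additive_separating_subspace:
  fixes F V :: "'a::field set"
  assumes F: "subfield_set F"
    and V: "\<And>x y. x \<in> V \<Longrightarrow> y \<in> V \<Longrightarrow> x + y \<in> V" "\<And>c x. c \<in> F \<Longrightarrow> x \<in> V \<Longrightarrow> c * x \<in> V"
      "0 \<in> V" "z \<notin> V"
  obtains f :: "'a \<Rightarrow> 'a" where "additive f" "\<And>x. x \<in> V \<Longrightarrow> f x = 0" "f z = 1"
proof -
  define B where "B = insert (+) ((\<lambda>c x y. c * x) ` F)"
  have B: "closed_under B S \<longleftrightarrow>
      (\<forall>x\<in>S. \<forall>y\<in>S. x + y \<in> S) \<and> (\<forall>c\<in>F. \<forall>x\<in>S. c * x \<in> S)" for S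
    by (auto simp: B_def closed_under_def)
  have "closed_under B V" using V by (simp add: B)
  then obtain N where N: "closed_under B N" "V \<subseteq> N" "z \<notin> N"
    and max: "\<And>T. closed_under B T \<Longrightarrow> N \<subseteq> T \<Longrightarrow> z \<notin> T \<Longrightarrow> T = N"
    using maximal_closed_avoiding[OF _ V(4)] by meson
  have F_ring: "0 \<in> F" "1 \<in> F" "\<And>c d. c \<in> F \<Longrightarrow> d \<in> F \<Longrightarrow> c + d \<in> F"
    "\<And>c d. c \<in> F \<Longrightarrow> d \<in> F \<Longrightarrow> c * d \<in> F" "\<And>c. c \<in> F \<Longrightarrow> - c \<in> F" "\<And>c. c \<in> F \<Longrightarrow> inverse c \<in> F"
    using F by (auto simp: subfield_set_def)
  have N_add: "x + y \<in> N" if "x \<in> N" "y \<in> N" for x y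
    using N(1) that by (simp add: B)
  have N_scale: "c * x \<in> N" if "c \<in> F" "x \<in> N" for c x
    using N(1) that by (simp add: B)
  have N_diff: "x - y \<in> N" if "x \<in> N" "y \<in> N" for x y
    using N_add[OF that(1) N_scale[of "- 1" y]] that F_ring by simp
  have N0: "0 \<in> N" using N(2) V(3) by blast
  have ex: "\<exists>c\<in>F. x - c * z \<in> N" for x
  proof (cases "x \<in> N")
    case True
    then show ?thesis using F_ring(1) by (intro bexI[of _ 0]) simp_all
  next
    case False
    define T where "T = {n + c * x |n c. n \<in> N \<and> c \<in> F}"
    have T: "n + c * x \<in> T" if "n \<in> N" "c \<in> F" for n c
      using that unfolding T_def by blast
    have T_cases: thesis if "a \<in> T" "\<And>n c. a = n + c * x \<Longrightarrow> n \<in> N \<Longrightarrow> c \<in> F \<Longrightarrow> thesis"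
      for a thesis
      using that unfolding T_def by blast
    have "closed_under B T"
      unfolding B
    proof (intro conjI ballI)
      fix a b assume "a \<in> T" "b \<in> T"
      then obtain n c m d where ab: "a = n + c * x" "b = m + d * x"
        and "n \<in> N" "c \<in> F" "m \<in> N" "d \<in> F"
        by (meson T_cases)
      then have "(n + m) + (c + d) * x \<in> T"
        by (intro T N_add F_ring)
      also have "(n + m) + (c + d) * x = a + b"
        by (simp add: ab algebra_simps)
      finally show "a + b \<in> T" .
    next
      fix e a assume "e \<in> F" "a \<in> T"
      then obtain n c where a: "a = n + c * x" and "n \<in> N" "c \<in> F"
        by (meson T_cases)
      with \<open>e \<in> F\<close> have "e * n + (e * c) * x \<in> T"
        by (intro T N_scale F_ring)
      also have "e * n + (e * c) * x = e * a"
        by (simp add: a algebra_simps)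
      finally show "e * a \<in> T" .
    qed
    moreover have "N \<subseteq> T"
      using T[OF _ F_ring(1)] by auto
    moreover have "x \<in> T"
      using T[OF N0 F_ring(2)] by simp
    ultimately have "z \<in> T"
      using max[of T] False by metis
    then obtain n c where nc: "z = n + c * x" "n \<in> N" "c \<in> F" by (meson T_cases)
    have c0: "c \<noteq> 0" using nc N(3) by auto
    have "x - inverse c * z = - inverse c * n"
      unfolding nc(1) using c0 by (simp add: field_simps)
    then have "x - inverse c * z \<in> N"
      using nc F_ring N_scale[of "- inverse c" n] by simp
    then show ?thesis by (rule bexI) (rule F_ring(6)[OF nc(3)])
  qed
  have uniq: "c = d" if "c \<in> F" "d \<in> F" "x - c * z \<in> N" "x - d * z \<in> N" for x c d
  proof (rule ccontr)
    assume "c \<noteq> d"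
    have "(d - c) * z \<in> N"
      using N_diff[OF that(3,4)] by (simp add: algebra_simps)
    moreover have "inverse (d - c) \<in> F"
      using that(1,2) F_ring(3)[of d "- c"] F_ring(5,6) by simp
    ultimately have "inverse (d - c) * ((d - c) * z) \<in> N"
      by (rule N_scale[rotated])
    then show False using \<open>c \<noteq> d\<close> N(3) by (simp add: mult.assoc[symmetric])
  qed
  obtain f where f: "\<And>x. f x \<in> F" "\<And>x. x - f x * z \<in> N"
    using ex by metis
  have "additive f"
  proof
    fix x y
    show "f (x + y) = f x + f y"
      using N_add[OF f(2)[of x] f(2)[of y]] f F_ring(3)
      by (intro uniq[of _ _ "x + y"]) (simp_all add: algebra_simps)
  qed
  moreover have "f x = 0" if "x \<in> V" for x
    using that N(2) f F_ring(1) by (intro uniq[of _ _ x]) auto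
  moreover have "f z = 1"
    using f F_ring(2) N0 by (intro uniq[of _ _ z]) auto
  ultimately show thesis by (rule that)
qed

section \<open>Valuation rings\<close>

abbreviation ring_ops :: "('a::ring \<Rightarrow> 'a \<Rightarrow> 'a) set" where
  "ring_ops \<equiv> {(+), (-), (*)}"

definition adjoin :: "'a::comm_ring_1 set \<Rightarrow> 'a \<Rightarrow> 'a set" where
  "adjoin V x = {poly p x |p. \<forall>i. coeff p i \<in> V}"

lemma closed_ring_sum:
  assumes "closed_under ring_ops V" "0 \<in> V" "\<And>i. i \<in> I \<Longrightarrow> g i \<in> V"
  shows "sum g I \<in> V"
  using assms(3)
  by (induction I rule: infinite_finite_induct) (use assms(1,2) in \<open>auto simp: closed_under_def\<close>)

lemma adjoin_ring:
  assumes V: "closed_under ring_ops V" "0 \<in> V"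
  shows "closed_under ring_ops (adjoin V x)"
proof -
  have cl: "a + b \<in> V" "a - b \<in> V" "a * b \<in> V" if "a \<in> V" "b \<in> V" for a b
    using V(1) that by (auto simp: closed_under_def)
  have "poly p x + poly q x \<in> adjoin V x" "poly p x - poly q x \<in> adjoin V x"
    "poly p x * poly q x \<in> adjoin V x"
    if "\<forall>i. coeff p i \<in> V" "\<forall>i. coeff q i \<in> V" for p q
  proof -
    show "poly p x + poly q x \<in> adjoin V x"
      unfolding adjoin_def using that cl by (intro CollectI exI[of _ "p + q"]) auto
    show "poly p x - poly q x \<in> adjoin V x"
      unfolding adjoin_def using that cl by (intro CollectI exI[of _ "p - q"]) auto
    show "poly p x * poly q x \<in> adjoin V x"
      unfolding adjoin_def using that cl
      by (intro CollectI exI[of _ "p * q"]) (auto simp: coeff_mult intro!: closed_ring_sum[OF V])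
  qed
  then show ?thesis
    unfolding closed_under_def by (auto simp: adjoin_def)
qed

lemma adjoin_base:
  assumes "0 \<in> V" shows "V \<subseteq> adjoin V x"
proof
  fix a assume "a \<in> V"
  then show "a \<in> adjoin V x"
    unfolding adjoin_def using assms
    by (intro CollectI exI[of _ "[:a:]"]) (auto simp: coeff_pCons split: nat.split)
qed

lemma adjoin_self:
  assumes "0 \<in> V" "1 \<in> V" shows "x \<in> adjoin V x"
  unfolding adjoin_def using assms
  by (intro CollectI exI[of _ "[:0, 1:]"]) (auto simp: coeff_pCons split: nat.split)

text \<open>The condition \<open>1/t \<notin> V\<close> says that \<open>1\<close> is not in the ideal \<open>t V\<close>. Hence by maximality every
  \<open>x \<notin> V\<close> yields a relation \<open>1 = \<Sum> m\<^sub>i x\<^sup>i\<close> with all \<open>m\<^sub>i \<in> t V\<close>.\<close>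

locale maximal_nonunit_ring =
  fixes V :: "'a::field set" and t :: 'a
  assumes ring: "closed_under ring_ops V" and one: "1 \<in> V"
    and t: "t \<in> V" "inverse t \<notin> V"
    and maximal: "\<And>T. closed_under ring_ops T \<Longrightarrow> V \<subseteq> T \<Longrightarrow> inverse t \<notin> T \<Longrightarrow> T = V"
begin

lemma add: "x \<in> V \<Longrightarrow> y \<in> V \<Longrightarrow> x + y \<in> V"
  and diff: "x \<in> V \<Longrightarrow> y \<in> V \<Longrightarrow> x - y \<in> V"
  and mult: "x \<in> V \<Longrightarrow> y \<in> V \<Longrightarrow> x * y \<in> V"
  using ring by (auto simp: closed_under_def)

lemma zero: "0 \<in> V"
  using diff[OF one one] by simp

lemma t_nonzero: "t \<noteq> 0"
  using t by auto

definition unity_relation :: "nat \<Rightarrow> 'a \<Rightarrow> bool" where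
  "unity_relation n x \<longleftrightarrow> (\<exists>a. (\<forall>i. a i \<in> V) \<and> (\<Sum>i\<le>n. t * a i * x ^ i) = 1)"

lemma unity_relation_if_notin:
  assumes "x \<notin> V"
  obtains n where "\<And>m. n \<le> m \<Longrightarrow> unity_relation m x"
proof -
  have "adjoin V x \<noteq> V"
    using adjoin_self[OF zero one] assms by blast
  then have "inverse t \<in> adjoin V x"
    using maximal[OF adjoin_ring[OF ring zero] adjoin_base[OF zero]] by blast
  then obtain p where p: "\<forall>i. coeff p i \<in> V" "poly p x = inverse t"
    by (auto simp: adjoin_def)
  have "unity_relation m x" if "degree p \<le> m" for m
  proof -
    have "(\<Sum>i\<le>m. t * coeff p i * x ^ i) = t * (\<Sum>i\<le>m. coeff p i * x ^ i)"
      by (simp add: sum_distrib_left mult.assoc)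
    also have "(\<Sum>i\<le>m. coeff p i * x ^ i) = poly p x"
      unfolding poly_altdef using that
      by (intro sum.mono_neutral_right) (auto simp: coeff_eq_0)
    finally show ?thesis
      using p t_nonzero by (auto simp: unity_relation_def)
  qed
  then show thesis by (rule that)
qed

lemma t_mult_ne_1: "v \<in> V \<Longrightarrow> t * v \<noteq> 1"
  using t(2) inverse_unique[of t v] by auto

text \<open>If \<open>s = 1 - t v\<close> were not a unit of \<open>V\<close>, a relation for \<open>1/s\<close>, multiplied by \<open>s\<^sup>n\<close>, would
  put \<open>s\<^sup>n\<close> into \<open>t V\<close>, although \<open>s\<^sup>n\<close> is congruent to 1 modulo \<open>t V\<close>.\<close>

lemma unit_one_minus:
  assumes "v \<in> V"
  shows "inverse (1 - t * v) \<in> V"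
proof (rule ccontr)
  let ?s = "1 - t * v"
  assume "inverse ?s \<notin> V"
  then obtain n where "unity_relation n (inverse ?s)"
    using unity_relation_if_notin by blast
  then obtain a where a: "\<And>i. a i \<in> V" "(\<Sum>i\<le>n. t * a i * inverse ?s ^ i) = 1"
    by (auto simp: unity_relation_def)
  have s: "?s \<noteq> 0" "?s \<in> V"
    using t_mult_ne_1[OF assms] one t assms by (auto intro!: diff mult)
  have pow: "?s ^ i \<in> V" for i
    by (induction i) (auto simp del: mult_1 intro: one mult s)
  have "\<exists>w\<in>V. ?s ^ i = 1 - t * w" for i
  proof (induction i)
    case (Suc i)
    then obtain w where "w \<in> V" "?s ^ i = 1 - t * w" by blast
    moreover from this have "?s ^ Suc i = 1 - t * (w + v * ?s ^ i)"
      by (simp add: algebra_simps)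
    ultimately show ?case
      using add mult pow assms by blast
  qed (use zero in force)
  then obtain w where w: "w \<in> V" "?s ^ n = 1 - t * w" by blast
  have "?s ^ n = ?s ^ n * (\<Sum>i\<le>n. t * a i * inverse ?s ^ i)"
    using a by simp
  also have "\<dots> = (\<Sum>i\<le>n. t * (a i * ?s ^ (n - i)))"
    unfolding sum_distrib_left using s(1)
    by (intro sum.cong) (auto simp: power_diff power_inverse divide_inverse mult_ac)
  also have "\<dots> = t * (\<Sum>i\<le>n. a i * ?s ^ (n - i))"
    by (simp add: sum_distrib_left)
  finally have "t * (w + (\<Sum>i\<le>n. a i * ?s ^ (n - i))) = 1"
    using w by (simp add: algebra_simps)
  moreover have "w + (\<Sum>i\<le>n. a i * ?s ^ (n - i)) \<in> V"
    by (intro add w closed_ring_sum[OF ring zero] mult a pow)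
  ultimately show False
    using t_mult_ne_1 by blast
qed

text \<open>The relation for \<open>1/x\<close>, multiplied by \<open>x\<^sup>n\<^sup>+\<^sup>1\<close>, expresses \<open>(1 - t b\<^sub>0) x\<^sup>n\<^sup>+\<^sup>1\<close> by lower powers
  of \<open>x\<close>. As \<open>1 - t b\<^sub>0\<close> is a unit, this eliminates the top term of the relation for \<open>x\<close>. Both
  relations may be taken of the same length since they can be padded with zeros, and so the
  step applies equally to \<open>1/x\<close>.\<close>

lemma unity_relation_reduce:
  assumes "unity_relation (Suc n) x" "unity_relation (Suc n) (inverse x)" "x \<noteq> 0"
  shows "unity_relation n x"
proof -
  obtain a b where a: "\<And>i. a i \<in> V" "(\<Sum>i\<le>Suc n. t * a i * x ^ i) = 1"
    and b: "\<And>i. b i \<in> V" "(\<Sum>i\<le>Suc n. t * b i * inverse x ^ i) = 1"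
    using assms(1,2) by (auto simp: unity_relation_def)
  define w where "w = inverse (1 - t * b 0)"
  define c where "c = t * a (Suc n) * w"
  have w: "w \<in> V" "w * (1 - t * b 0) = 1"
    using unit_one_minus[OF b(1)] t_mult_ne_1[OF b(1)[of 0]] by (auto simp: w_def)
  have "x ^ Suc n = x ^ Suc n * (\<Sum>i\<le>Suc n. t * b i * inverse x ^ i)"
    using b by simp
  also have "\<dots> = (\<Sum>i\<le>Suc n. t * b i * x ^ (Suc n - i))"
    unfolding sum_distrib_left using assms(3)
    by (intro sum.cong) (auto simp: power_diff power_inverse divide_inverse mult_ac)
  also have "\<dots> = (\<Sum>i\<le>Suc n. t * b (Suc n - i) * x ^ i)"
    by (rule sum.reindex_bij_witness[of _ "\<lambda>i. Suc n - i" "\<lambda>i. Suc n - i"]) auto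
  also have "\<dots> = (\<Sum>i\<le>n. t * b (Suc n - i) * x ^ i) + t * b 0 * x ^ Suc n"
    by simp
  finally have "(\<Sum>i\<le>n. t * b (Suc n - i) * x ^ i) = (1 - t * b 0) * x ^ Suc n"
    unfolding left_diff_distrib mult_1_left eq_diff_eq by (rule sym)
  then have "c * (\<Sum>i\<le>n. t * b (Suc n - i) * x ^ i) = t * a (Suc n) * x ^ Suc n"
    using w(2) by (simp add: c_def mult.assoc[symmetric] del: power_Suc)
  then have "(\<Sum>i\<le>n. t * (a i + c * b (Suc n - i)) * x ^ i) = 1"
    using a(2) by (simp add: algebra_simps sum.distrib sum_distrib_left del: power_Suc)
  moreover have "a i + c * b (Suc n - i) \<in> V" for i
    unfolding c_def by (intro add mult a b w t)
  ultimately show ?thesis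
    unfolding unity_relation_def by (intro exI[of _ "\<lambda>i. a i + c * b (Suc n - i)"]) simp
qed

text \<open>Repeated reduction would end with relations of length 0, that is, with \<open>1 \<in> t V\<close>.\<close>

lemma valuation_ring:
  assumes "x \<noteq> 0"
  shows "x \<in> V \<or> inverse x \<in> V"
proof (rule ccontr)
  assume "\<not> (x \<in> V \<or> inverse x \<in> V)"
  then obtain n m where "\<And>k. n \<le> k \<Longrightarrow> unity_relation k x"
    "\<And>k. m \<le> k \<Longrightarrow> unity_relation k (inverse x)"
    using unity_relation_if_notin by metis
  then have "unity_relation (max n m) x \<and> unity_relation (max n m) (inverse x)"
    by simp
  moreover have "\<not> (unity_relation k x \<and> unity_relation k (inverse x))" for k
  proof (induction k)
    case 0
    show ?case
      using t_mult_ne_1 by (auto simp: unity_relation_def)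
  next
    case (Suc k)
    then show ?case
      using unity_relation_reduce[of k x] unity_relation_reduce[of k "inverse x"] assms by auto
  qed
  ultimately show False by blast
qed

end

text \<open>If \<open>1/t = p(t)\<close> with \<open>p\<close> over \<open>F\<close>, then \<open>t\<close> is a root of the nonzero polynomial \<open>X p - 1\<close>;
  so \<open>F[t]\<close> is a subring to start from.\<close>

lemma maximal_nonunit_ring_exists:
  assumes F: "subfield_set F" and t: "transcendental_over F t"
  obtains V where "maximal_nonunit_ring V t" "F \<subseteq> V"
proof -
  have F_ring: "closed_under ring_ops F" "0 \<in> F" "1 \<in> F" "- 1 \<in> F"
    using F unfolding closed_under_def subfield_set_def
    by (auto simp: diff_conv_add_uminus simp del: add_uminus_conv_diff)
  have no_root: "p = 0" if "\<forall>i. coeff p i \<in> F" "poly p t = 0" for p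
    using t that by (auto simp: transcendental_over_def)
  have "t \<noteq> 0"
  proof
    assume "t = 0"
    then have "[:0, 1:] = (0 :: 'a poly)"
      using F_ring by (intro no_root) (auto simp: coeff_pCons split: nat.split)
    then show False by simp
  qed
  have "inverse t \<notin> adjoin F t"
  proof
    assume "inverse t \<in> adjoin F t"
    then obtain p where "\<forall>i. coeff p i \<in> F" "poly p t = inverse t"
      by (auto simp: adjoin_def)
    then have "pCons (- 1) p = 0"
      using F_ring \<open>t \<noteq> 0\<close> by (intro no_root) (auto simp: coeff_pCons split: nat.split)
    then show False by simp
  qed
  with adjoin_ring[OF F_ring(1,2)] obtain V where
    V: "closed_under ring_ops V" "adjoin F t \<subseteq> V" "inverse t \<notin> V"
      "\<And>T. closed_under ring_ops T \<Longrightarrow> V \<subseteq> T \<Longrightarrow> inverse t \<notin> T \<Longrightarrow> T = V"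
    using maximal_closed_avoiding by meson
  have "F \<subseteq> V" "t \<in> V"
    using V(2) adjoin_base[OF F_ring(2)] adjoin_self[OF F_ring(2,3)] by blast+
  then show thesis
    using V F_ring(3) by (intro that[of V]) (unfold_locales, auto)
qed

theorem mainTheorem2:
  shows "(\<exists>f :: 'a::field \<Rightarrow> 'a. additive f \<and> (\<exists>x. f x \<noteq> 0) \<and>
            (\<forall>x. x \<noteq> 0 \<longrightarrow> f x * f (1 / x) = 0)) \<longleftrightarrow>
         (\<exists>x :: 'a. transcendental_over prime_subfield x)"
proof
  assume "\<exists>f :: 'a \<Rightarrow> 'a. additive f \<and> (\<exists>x. f x \<noteq> 0) \<and>
            (\<forall>x. x \<noteq> 0 \<longrightarrow> f x * f (1 / x) = 0)"
  then show "\<exists>x :: 'a. transcendental_over prime_subfield x"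
    using additive_inversion_transcendental by blast
next
  assume "\<exists>x :: 'a. transcendental_over prime_subfield x"
  then obtain t :: 'a where "transcendental_over prime_subfield t" ..
  then obtain V where V: "maximal_nonunit_ring V t" "prime_subfield \<subseteq> V"
    using maximal_nonunit_ring_exists[OF subfield_set_prime_subfield] by blast
  interpret maximal_nonunit_ring V t by fact
  obtain f :: "'a \<Rightarrow> 'a" where "additive f" "\<And>x. x \<in> V \<Longrightarrow> f x = 0" "f (inverse t) = 1"
    using additive_separating_subspace[OF subfield_set_prime_subfield, of V "inverse t"]
      add mult zero t V(2) by blast
  moreover from this valuation_ring have "\<forall>x. x \<noteq> 0 \<longrightarrow> f x * f (1 / x) = 0"
    by (metis inverse_eq_divide mult_eq_0_iff)
  ultimately show "\<exists>f :: 'a \<Rightarrow> 'a. additive f \<and> (\<exists>x. f x \<noteq> 0) \<and>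
            (\<forall>x. x \<noteq> 0 \<longrightarrow> f x * f (1 / x) = 0)"
    by (metis zero_neq_one)
qed

end
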